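(* Let $a>0$. For $x\ge 0$ put $k=\lfloor |x-a|\rfloor$. For $x\ge a$ define $$u(x,a,1)=\prod_{0\le i\le k}\frac{a}{x-i},$$ and for $0\le x\le a$ define $$\ell(x,a,1)=\prod_{0<i\le k}\frac{x+i}{a},$$ where the products run over integers $i$ and an empty product equals $1$. Then for every $x\ge a$, $$u(x,a,1)\ \le\ \frac{a^{x-a}\,\Gamma(a+1)}{\Gamma(x+1)},$$ and for every $x$ with $0\le x\le a$, $$\ell(x,a,1)\ \le\ \frac{\Gamma(a+1)}{a^{a-x}\,\Gamma(x+1)},$$ with, in each case, equality if and only if $x-a$ is an integer.
   Context: $\Gamma$ denotes the usual Gamma function, and $\lfloor\cdot\rfloor$ the floor function. *)

theory Defs
  imports "HOL-Analysis.Gamma_Function"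
begin

text \<open>
  The functions $u(x,a,1)$ and $\ell(x,a,1)$; the third argument is fixed to 1 throughout and is
  part of the names.  The mathematical domains are $x \ge a > 0$ for \<open>u1\<close>, where all
  denominators are at least \<open>a\<close>, and $0 \le x \le a$ for \<open>l1\<close>; values elsewhere
  are irrelevant.
\<close>

definition u1 :: "real \<Rightarrow> real \<Rightarrow> real" where
  "u1 x a = (let k = \<lfloor>\<bar>x - a\<bar>\<rfloor> in \<Prod>i\<in>{0..k}. a / (x - of_int i))"

definition l1 :: "real \<Rightarrow> real \<Rightarrow> real" where
  "l1 x a = (let k = \<lfloor>\<bar>x - a\<bar>\<rfloor> in \<Prod>i\<in>{0<..k}. (x + of_int i) / a)"

end

theory Submission
  imports Defs
begin

text \<open>
  Write $y = x - k$ in the first case and $y = x + k + 1$ in the second. In each case the product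
  telescopes by the functional equation $\Gamma(z+1) = z\,\Gamma(z)$ to a power of \<open>a\<close> times
  $\Gamma(y)/\Gamma(x+1)$, where $a \le y \le a + 1$ because \<open>k\<close> is the integer part of $|x-a|$
  (\<open>prod_divide_diff_eq_Gamma\<close>, \<open>prod_add_divide_eq_Gamma\<close>).
  With $y = a + t$, both claims therefore reduce to Wendel's inequality
  $\Gamma(a+t) \le a^t\,\Gamma(a)$ for $0 \le t \le 1$, with equality exactly at the endpoints
  (\<open>Gamma_less_powr_mult_Gamma\<close>).
  That inequality says that the strictly convex function $\ln\Gamma$ lies below its chord
  from \<open>a\<close> to $a+1$, strictly so in between, whose slope is $\ln\Gamma(a+1) - \ln\Gamma(a) = \ln a$. The endpoints
  $t = 0$ and $t = 1$ correspond to $x - a$ being an integer.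
\<close>

lemma Gamma_plus1_real_pos: "x > 0 \<Longrightarrow> Gamma (x + 1) = x * Gamma x" for x :: real
  by (intro Gamma_plus1) (auto elim!: nonpos_Ints_cases)

text \<open>
  Strict log-convexity of the Gamma function, in the form of a comparison with the chord over a
  unit interval: the derivative of $\ln\Gamma$ is the strictly increasing digamma function, so the
  mean slope over \<open>[a, a + t]\<close> is smaller than that over \<open>[a + t, a + 1]\<close>.
\<close>

lemma Gamma_less_powr_mult_Gamma:
  fixes a t :: real
  assumes a: "a > 0" and t: "0 < t" "t < 1"
  shows "Gamma (a + t) < a powr t * Gamma a"
proof -
  have deriv: "(ln_Gamma has_real_derivative Digamma z) (at z)" if "z > 0" for z :: real
    using that by (rule has_field_derivative_ln_Gamma_real)
  obtain p where p: "a < p" "p < a + t" "ln_Gamma (a + t) - ln_Gamma a = t * Digamma p"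
    using MVT2[of a "a + t" ln_Gamma Digamma] a t deriv by auto
  obtain q where q: "a + t < q" "q < a + 1"
      "ln_Gamma (a + 1) - ln_Gamma (a + t) = (1 - t) * Digamma q"
    using MVT2[of "a + t" "a + 1" ln_Gamma Digamma] a t deriv by auto
  have "Digamma p < Digamma q"
    using a p q by (intro Digamma_real_strict_mono) auto
  then have "t * (1 - t) * Digamma p < t * (1 - t) * Digamma q"
    using t by (intro mult_strict_left_mono) auto
  then have "(1 - t) * (ln_Gamma (a + t) - ln_Gamma a) < t * (ln_Gamma (a + 1) - ln_Gamma (a + t))"
    unfolding p(3) q(3) by (simp add: algebra_simps)
  moreover have "ln_Gamma (a + 1) = ln a + ln_Gamma a"
    using a Gamma_real_pos[OF a]
    by (simp add: ln_Gamma_real_pos Gamma_plus1_real_pos ln_mult_pos del: Gamma_real_pos)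
  ultimately have "ln_Gamma (a + t) < t * ln a + ln_Gamma a"
    by (simp add: algebra_simps)
  then have "exp (ln_Gamma (a + t)) < exp (t * ln a + ln_Gamma a)"
    by simp
  then show ?thesis
    using a t by (simp add: Gamma_real_pos_exp exp_add powr_def)
qed

text \<open>
  The right-hand side is scaled to $\Gamma(a+1)$, the form in which it appears in both bounds.
\<close>

lemma Gamma_le_powr_mult_Gamma_plus1:
  fixes a t :: real
  assumes a: "a > 0" and t: "0 \<le> t" "t \<le> 1"
  shows "Gamma (a + t) \<le> a powr (t - 1) * Gamma (a + 1)"
    and "Gamma (a + t) = a powr (t - 1) * Gamma (a + 1) \<longleftrightarrow> t = 0 \<or> t = 1"
proof -
  have G: "Gamma (a + 1) = a * Gamma a"
    using a by (rule Gamma_plus1_real_pos)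
  have R: "a powr (t - 1) * Gamma (a + 1) = a powr t * Gamma a"
    using a unfolding G by (simp add: powr_diff)
  consider "t = 0" | "t = 1" | "0 < t" "t < 1"
    using t by linarith
  then have "Gamma (a + t) \<le> a powr t * Gamma a \<and>
      (Gamma (a + t) = a powr t * Gamma a \<longleftrightarrow> t = 0 \<or> t = 1)"
  proof cases
    case 3
    then show ?thesis
      using Gamma_less_powr_mult_Gamma[of a t] a by auto
  qed (use a G in auto)
  then show "Gamma (a + t) \<le> a powr (t - 1) * Gamma (a + 1)"
    and "Gamma (a + t) = a powr (t - 1) * Gamma (a + 1) \<longleftrightarrow> t = 0 \<or> t = 1"
    unfolding R by auto
qed

lemma prod_divide_diff_eq_Gamma:
  fixes a x :: real
  assumes "x > of_nat n"
  shows "(\<Prod>i\<in>{0..int n}. a / (x - of_int i)) = a ^ (n + 1) * Gamma (x - of_nat n) / Gamma (x + 1)"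
  using assms
proof (induction n)
  case 0
  have "Gamma (x + 1) = x * Gamma x"
    using 0 by (intro Gamma_plus1_real_pos) simp
  moreover have "Gamma x > 0"
    using 0 by (intro Gamma_real_pos) auto
  ultimately show ?case by simp
next
  case (Suc n)
  define z where "z = x - of_nat (Suc n)"
  have z: "z > 0" "x - of_nat n = z + 1" "x - (1 + of_nat n) = z"
    using Suc.prems by (auto simp: z_def)
  have "Gamma (z + 1) = z * Gamma z"
    using z by (intro Gamma_plus1_real_pos)
  moreover have "{0..int (Suc n)} = insert (int (Suc n)) {0..int n}" by auto
  moreover have "x - of_int (int (Suc n)) = z" by (simp add: z_def)
  ultimately have "(\<Prod>i\<in>{0..int (Suc n)}. a / (x - of_int i)) =
      a / z * (a ^ (n + 1) * (z * Gamma z) / Gamma (x + 1))"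
    using Suc z by simp
  also have "\<dots> = a ^ (Suc n + 1) * Gamma z / Gamma (x + 1)"
    using z by simp
  finally show ?case by (simp only: z_def)
qed

lemma prod_add_divide_eq_Gamma:
  fixes a x :: real
  assumes "x \<ge> 0"
  shows "(\<Prod>i\<in>{0<..int n}. (x + of_int i) / a) = Gamma (x + of_nat n + 1) / (a ^ n * Gamma (x + 1))"
proof (induction n)
  case 0
  have "Gamma (x + 1) > 0"
    using assms by (intro Gamma_real_pos) auto
  then show ?case by simp
next
  case (Suc n)
  define z where "z = x + of_nat (Suc n)"
  have z: "z > 0" "x + of_nat n + 1 = z" "x + (1 + of_nat n) = z"
    using assms by (auto simp: z_def)
  have "Gamma (z + 1) = z * Gamma z"
    using z by (intro Gamma_plus1_real_pos)
  moreover have "{0<..int (Suc n)} = insert (int (Suc n)) {0<..int n}" by auto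
  moreover have "x + of_int (int (Suc n)) = z" by (simp add: z_def)
  ultimately have "(\<Prod>i\<in>{0<..int (Suc n)}. (x + of_int i) / a) =
      Gamma (z + 1) / (a ^ Suc n * Gamma (x + 1))"
    using Suc z by simp
  then show ?case by (simp only: z_def)
qed

lemma u1_bound:
  fixes a x :: real
  assumes a: "a > 0" and x: "x \<ge> a"
  shows "u1 x a \<le> a powr (x - a) * Gamma (a + 1) / Gamma (x + 1)"
    and "u1 x a = a powr (x - a) * Gamma (a + 1) / Gamma (x + 1) \<longleftrightarrow> x - a \<in> \<int>"
proof -
  define n where "n = nat \<lfloor>x - a\<rfloor>"
  define t where "t = frac (x - a)"
  have n: "\<lfloor>\<bar>x - a\<bar>\<rfloor> = int n"
    using x by (simp add: n_def)
  have xt: "x - a = of_nat n + t"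
    using x by (simp add: n_def t_def frac_def)
  have t: "0 \<le> t" "t < 1" "t = 0 \<longleftrightarrow> x - a \<in> \<int>"
    by (simp_all add: t_def frac_lt_1)
  define C where "C = a ^ (n + 1) / Gamma (x + 1)"
  have C: "C > 0"
    using a x by (simp add: C_def)
  have L: "u1 x a = C * Gamma (a + t)"
  proof -
    have "x - of_nat n = a + t" "x > of_nat n"
      using xt a t by linarith+
    then show ?thesis
      using prod_divide_diff_eq_Gamma[of n x a] by (simp add: u1_def n C_def)
  qed
  have R: "a powr (x - a) * Gamma (a + 1) / Gamma (x + 1) = C * (a powr (t - 1) * Gamma (a + 1))"
  proof -
    have "a powr (x - a) = a powr (of_nat (n + 1) + (t - 1))"
      by (simp add: xt)
    also have "\<dots> = a ^ (n + 1) * a powr (t - 1)"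
      using a by (simp only: powr_add powr_realpow)
    finally show ?thesis by (simp add: C_def)
  qed
  show "u1 x a \<le> a powr (x - a) * Gamma (a + 1) / Gamma (x + 1)"
    and "u1 x a = a powr (x - a) * Gamma (a + 1) / Gamma (x + 1) \<longleftrightarrow> x - a \<in> \<int>"
    unfolding L R using Gamma_le_powr_mult_Gamma_plus1[of a t] a t C by auto
qed

lemma l1_bound:
  fixes a x :: real
  assumes a: "a > 0" and x: "0 \<le> x" "x \<le> a"
  shows "l1 x a \<le> Gamma (a + 1) / (a powr (a - x) * Gamma (x + 1))"
    and "l1 x a = Gamma (a + 1) / (a powr (a - x) * Gamma (x + 1)) \<longleftrightarrow> x - a \<in> \<int>"
proof -
  define n where "n = nat \<lfloor>a - x\<rfloor>"
  \<comment> \<open>The complement of the fractional part, so that an integral difference now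
    corresponds to the right endpoint of the chord.\<close>
  define t where "t = 1 - frac (a - x)"
  have n: "\<lfloor>\<bar>x - a\<bar>\<rfloor> = int n"
    using x by (simp add: n_def)
  have xt: "a - x = of_nat n + (1 - t)"
    using x by (simp add: n_def t_def frac_def)
  have "a - x \<in> \<int> \<longleftrightarrow> x - a \<in> \<int>"
    using minus_in_Ints_iff[of "x - a"] by simp
  then have t: "0 < t" "t \<le> 1" "t = 1 \<longleftrightarrow> x - a \<in> \<int>"
    by (simp_all add: t_def frac_lt_1)
  define C where "C = 1 / (a ^ n * Gamma (x + 1))"
  have C: "C > 0"
    using a x by (simp add: C_def)
  have L: "l1 x a = C * Gamma (a + t)"
  proof -
    have "x + of_nat n + 1 = a + t"
      using xt by linarith
    then show ?thesis
      using prod_add_divide_eq_Gamma[OF x(1), where a = a and n = n] by (simp only: l1_def Let_def n C_def) simp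
  qed
  have R: "Gamma (a + 1) / (a powr (a - x) * Gamma (x + 1)) = C * (a powr (t - 1) * Gamma (a + 1))"
  proof -
    have "a powr (a - x) = a ^ n * a powr (1 - t)"
      using a by (simp only: xt powr_add powr_realpow)
    also have "a powr (1 - t) = 1 / a powr (t - 1)"
      using powr_minus_divide[of a "t - 1"] by simp
    finally show ?thesis by (simp add: C_def)
  qed
  show "l1 x a \<le> Gamma (a + 1) / (a powr (a - x) * Gamma (x + 1))"
    and "l1 x a = Gamma (a + 1) / (a powr (a - x) * Gamma (x + 1)) \<longleftrightarrow> x - a \<in> \<int>"
    unfolding L R using Gamma_le_powr_mult_Gamma_plus1[of a t] a t C by auto
qed

theorem theorem1p2:
  fixes a :: real
  assumes "a > 0"
  shows "(\<forall>x\<ge>a. u1 x a \<le> a powr (x - a) * Gamma (a + 1) / Gamma (x + 1)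
           \<and> (u1 x a = a powr (x - a) * Gamma (a + 1) / Gamma (x + 1) \<longleftrightarrow> x - a \<in> \<int>))
       \<and> (\<forall>x. 0 \<le> x \<and> x \<le> a \<longrightarrow>
           l1 x a \<le> Gamma (a + 1) / (a powr (a - x) * Gamma (x + 1))
           \<and> (l1 x a = Gamma (a + 1) / (a powr (a - x) * Gamma (x + 1)) \<longleftrightarrow> x - a \<in> \<int>))"
  using u1_bound l1_bound assms by blast

end
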